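(* Let $P$ be a transition matrix on a countable state space $S$ and let $\mu$ and $\nu$ be supercritical offspring distributions such that $\mu\leq_{\mathrm{germ}}\nu$. Then every $\nu$-transient set $A\subseteq S$ is $\mu$-transient, and every $\mu$-recurrent set $A\subseteq S$ is $\nu$-recurrent.
   Context: $S$ is a countable (nonempty) set and $P$ is the transition matrix of a Markov chain on $S$. An offspring distribution is a probability measure $\mu$ on $\{0,1,2,\ldots\}$; its mean is $\bar\mu=\sum_{n\ge 0} n\mu(n)\in[0,\infty]$, and $\mu$ is supercritical if $\bar\mu>1$. For a probability measure $\mu$ on $[0,\infty)$, its probability generating function is $\mathcal{P}_\mu(t)=\int_0^\infty t^x\,d\mu(x)$ for $t\in[0,1]$. The germ order on probability measures on $[0,\infty)$ is defined by: $\mu\leq_{\mathrm{germ}}\nu$ if and only if there exists $\varepsilon>0$ such that $\mathcal{P}_\mu(t)\ge\mathcal{P}_\nu(t)$ for every $1-\varepsilon\le t\le 1$. The branching Markov process $(B_n)_{n\ge 0}$ associated to $(P,\mu)$ takes values in finitely supported functions $S\to\{0,1,2,\ldots\}$, where $B_n(y)$ is the number of particles at state $y$ at time $n$. It starts from a single particle at some $x\in S$. At each time step, each particle is independently replaced by a random number of new particles with law $\mu$, and each new particle immediately performs an independent step of the Markov chain with transition matrix $P$ from its parent's location. Its law is denoted $\mathbf{P}_x^\mu$. For $A\subseteq S$, $L(A)=\sum_{a\in A}\sum_{n\ge 0}B_n(a)\in[0,\infty]$ is the total number of particles that ever visit $A$. $\Omega_\infty$ is the event that the process survives forever, i.e.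 $\sum_{y\in S}B_n(y)>0$ for every $n$. A set $A\subseteq S$ is $\mu$-recurrent if for every $x\in S$ we have $\mathbf{P}_x^\mu(\Omega_\infty)>0$ and $\mathbf{P}_x^\mu(L(A)=\infty\mid\Omega_\infty)=1$. A set $A\subseteq S$ is $\mu$-transient if $\mathbf{P}_x^\mu(L(A)=\infty)=0$ for every $x\in S$. *)

theory Defs
  imports "HOL-Probability.Probability"
begin

definition offspring_mean :: "nat pmf \<Rightarrow> ennreal" where
  "offspring_mean \<mu> = (\<integral>\<^sup>+ n. of_nat n \<partial>measure_pmf \<mu>)"

definition supercritical :: "nat pmf \<Rightarrow> bool" where
  "supercritical \<mu> \<longleftrightarrow> offspring_mean \<mu> > 1"

definition pgf :: "nat pmf \<Rightarrow> real \<Rightarrow> real" where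
  "pgf \<mu> t = (\<integral> n. t ^ n \<partial>measure_pmf \<mu>)"

text \<open>The generating function is only considered on \<open>[0,1]\<close>, so \<open>t\<close> is confined to this interval
  also when \<open>\<epsilon> > 1\<close>.\<close>

definition germ_le :: "nat pmf \<Rightarrow> nat pmf \<Rightarrow> bool" where
  "germ_le \<mu> \<nu> \<longleftrightarrow> (\<exists>\<epsilon>>0. \<forall>t\<in>{0..1}. 1 - \<epsilon> \<le> t \<longrightarrow> pgf \<mu> t \<ge> pgf \<nu> t)"

text \<open>
  A transition matrix is a map \<open>P :: 's \<Rightarrow> 's pmf\<close> with entries \<open>pmf (P x) y\<close>. A configuration, that
  is, a finitely supported function \<open>'s \<Rightarrow> nat\<close>, is a multiset \<open>b\<close>; \<open>count b y\<close> is the number of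
  particles at \<open>y\<close>, and \<open>size b\<close> the total number of particles.

  The particles present at time \<open>n\<close> are labelled by triples \<open>(n, y, i)\<close> with \<open>i < count b y\<close>.
  Every label (whether used or not) independently carries a number of children with law \<open>\<mu>\<close> and an
  independent sequence of independent steps with law \<open>P y\<close>, the \<open>j\<close>-th of which is the position
  of its \<open>j\<close>-th child.
\<close>

type_synonym 's reproduction = "nat \<times> (nat \<Rightarrow> 's)"

definition reproduction_law :: "('s \<Rightarrow> 's pmf) \<Rightarrow> nat pmf \<Rightarrow> 's \<Rightarrow> 's reproduction measure" where
  "reproduction_law P \<mu> y = measure_pmf \<mu> \<Otimes>\<^sub>M (\<Pi>\<^sub>M j\<in>UNIV. measure_pmf (P y))"

definition noise :: "('s \<Rightarrow> 's pmf) \<Rightarrow> nat pmf \<Rightarrow> (nat \<times> 's \<times> nat \<Rightarrow> 's reproduction) measure" where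
  "noise P \<mu> = (\<Pi>\<^sub>M (n, y, i)\<in>UNIV. reproduction_law P \<mu> y)"

definition children :: "'s reproduction \<Rightarrow> 's multiset" where
  "children r = (\<Sum>j<fst r. {#snd r j#})"

primrec branching :: "'s \<Rightarrow> (nat \<times> 's \<times> nat \<Rightarrow> 's reproduction) \<Rightarrow> nat \<Rightarrow> 's multiset" where
  "branching x \<omega> 0 = {#x#}"
| "branching x \<omega> (Suc n) =
     (\<Sum>y\<in>set_mset (branching x \<omega> n). \<Sum>i<count (branching x \<omega> n) y. children (\<omega> (n, y, i)))"

abbreviation trajectory_space :: "(nat \<Rightarrow> 's multiset) measure" where
  "trajectory_space \<equiv> (\<Pi>\<^sub>M n\<in>UNIV. count_space UNIV)"

definition branching_law :: "('s \<Rightarrow> 's pmf) \<Rightarrow> nat pmf \<Rightarrow> 's \<Rightarrow> (nat \<Rightarrow> 's multiset) measure" where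
  "branching_law P \<mu> x = distr (noise P \<mu>) trajectory_space (branching x)"

definition visits :: "'s set \<Rightarrow> (nat \<Rightarrow> 's multiset) \<Rightarrow> ennreal" where
  "visits A B = (\<Sum>\<^sub>\<infinity>a\<in>A. \<Sum>n. of_nat (count (B n) a))"

definition survives :: "(nat \<Rightarrow> 's multiset) \<Rightarrow> bool" where
  "survives B \<longleftrightarrow> (\<forall>n. size (B n) > 0)"

definition recurrent_set :: "('s \<Rightarrow> 's pmf) \<Rightarrow> nat pmf \<Rightarrow> 's set \<Rightarrow> bool" where
  "recurrent_set P \<mu> A \<longleftrightarrow> (\<forall>x.
     \<P>(B in branching_law P \<mu> x. survives B) > 0 \<and>
     \<P>(B in branching_law P \<mu> x. visits A B = \<infinity> \<bar> survives B) = 1)"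

definition transient_set :: "('s \<Rightarrow> 's pmf) \<Rightarrow> nat pmf \<Rightarrow> 's set \<Rightarrow> bool" where
  "transient_set P \<mu> A \<longleftrightarrow> (\<forall>x. \<P>(B in branching_law P \<mu> x. visits A B = \<infinity>) = 0)"

text \<open>
  For a countable state space the process is a measurable function of the noise, so that its law is
  a probability measure, and the events used above are measurable.
\<close>

lemma countable_UNIV_multiset: "countable (UNIV :: 's::countable multiset set)"
proof -
  have "(UNIV :: 's multiset set) = range mset"
    by (metis surj_def ex_mset)
  then show ?thesis by (metis countableI_type countable_image)
qed

lemma prob_space_reproduction_law: "prob_space (reproduction_law P \<mu> y)"
proof -
  interpret J: product_prob_space "\<lambda>_. measure_pmf (P y)" "UNIV :: nat set" ..
  interpret pair_prob_space "measure_pmf \<mu>" "\<Pi>\<^sub>M j\<in>(UNIV :: nat set). measure_pmf (P y)" ..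
  show ?thesis unfolding reproduction_law_def by (rule prob_space_axioms)
qed

lemma prob_space_noise: "prob_space (noise P \<mu>)"
  unfolding noise_def
  by (rule prob_space_PiM) (auto simp: prob_space_reproduction_law split: prod.split)

lemma measurable_children:
  fixes P :: "'s::countable \<Rightarrow> 's pmf"
  shows "children \<in> measurable (reproduction_law P \<mu> y) (count_space UNIV)"
proof -
  let ?M = "reproduction_law P \<mu> y"
  have fst: "fst \<in> measurable ?M (count_space UNIV)"
    unfolding reproduction_law_def
    by (rule measurable_compose[OF measurable_fst]) simp
  have snd: "(\<lambda>r. snd r j) \<in> measurable ?M (count_space UNIV)" for j
  proof -
    have "(\<lambda>r. snd r j) \<in> measurable ?M (measure_pmf (P y))"
      unfolding reproduction_law_def by measurable
    then show ?thesis by (simp cong: measurable_cong_sets)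
  qed
  have "(\<lambda>r. \<Sum>j<k. {#snd r j#}) \<in> measurable ?M (count_space UNIV)" for k
  proof (induction k)
    case (Suc k)
    have "(\<lambda>r. (\<lambda>s r. (\<Sum>j<k. {#snd r j#}) + {#s#}) (snd r k) r) \<in> measurable ?M (count_space UNIV)"
      by (rule measurable_compose_countable[OF _ snd])
        (rule measurable_compose[OF Suc], simp)
    then show ?case by simp
  qed simp
  from measurable_compose_countable[OF this fst] show ?thesis
    unfolding children_def[abs_def] .
qed

lemma measurable_multiset_sum:
  fixes f :: "'i \<Rightarrow> 'a \<Rightarrow> 's::countable multiset"
  assumes "finite I" "\<And>i. i \<in> I \<Longrightarrow> f i \<in> measurable M (count_space UNIV)"
  shows "(\<lambda>\<omega>. \<Sum>i\<in>I. f i \<omega>) \<in> measurable M (count_space UNIV)"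
  using assms
proof (induction I rule: finite_induct)
  case (insert i I)
  have f: "f i \<in> measurable M (count_space UNIV)"
    and S: "(\<lambda>\<omega>. \<Sum>i\<in>I. f i \<omega>) \<in> measurable M (count_space UNIV)"
    using insert by auto
  have "(\<lambda>\<omega>. (\<lambda>b \<omega>. b + (\<Sum>i\<in>I. f i \<omega>)) (f i \<omega>) \<omega>) \<in> measurable M (count_space UNIV)"
    by (rule measurable_compose_countable'[OF _ f countable_UNIV_multiset])
      (rule measurable_compose[OF S], simp)
  then show ?case using insert by simp
qed simp

lemma measurable_branching_component:
  fixes P :: "'s::countable \<Rightarrow> 's pmf"
  shows "(\<lambda>\<omega>. branching x \<omega> n) \<in> measurable (noise P \<mu>) (count_space UNIV)"
proof (induction n)
  case (Suc n)
  have c: "(\<lambda>\<omega>. children (\<omega> (n, y, i))) \<in> measurable (noise P \<mu>) (count_space UNIV)" for y i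
  proof (rule measurable_compose[OF _ measurable_children[of P \<mu> y]])
    show "(\<lambda>\<omega>. \<omega> (n, y, i)) \<in> measurable (noise P \<mu>) (reproduction_law P \<mu> y)"
      unfolding noise_def
      using measurable_component_singleton[of "(n, y, i)" UNIV "\<lambda>(n, y, i). reproduction_law P \<mu> y"]
      by simp
  qed
  have "(\<lambda>\<omega>. (\<lambda>b \<omega>. \<Sum>y\<in>set_mset b. \<Sum>i<count b y. children (\<omega> (n, y, i))) (branching x \<omega> n) \<omega>)
      \<in> measurable (noise P \<mu>) (count_space UNIV)"
    by (rule measurable_compose_countable'[OF _ Suc countable_UNIV_multiset])
      (intro measurable_multiset_sum c; simp)
  then show ?case by simp
qed simp

lemma measurable_branching:
  fixes P :: "'s::countable \<Rightarrow> 's pmf"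
  shows "branching x \<in> measurable (noise P \<mu>) trajectory_space"
  by (rule measurable_PiM_single') (auto simp: measurable_branching_component)

lemma prob_space_branching_law:
  fixes P :: "'s::countable \<Rightarrow> 's pmf"
  shows "prob_space (branching_law P \<mu> x)"
  unfolding branching_law_def
  by (rule prob_space.prob_space_distr[OF prob_space_noise measurable_branching])

lemma sets_branching_law [measurable_cong]: "sets (branching_law P \<mu> x) = sets trajectory_space"
  by (simp add: branching_law_def)

lemma measurable_survives: "Measurable.pred trajectory_space survives"
  unfolding survives_def[abs_def] by measurable

lemma measurable_visits:
  fixes A :: "'s::countable set"
  shows "visits A \<in> borel_measurable trajectory_space"
proof -
  have "visits A B = (\<Squnion>F\<in>{F. finite F \<and> F \<subseteq> A}. \<Sum>a\<in>F. \<Sum>n. of_nat (count (B n) a))" for B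
    unfolding visits_def by (rule nonneg_infsum_complete) simp
  then have eq: "visits A =
      (\<lambda>B. \<Squnion>F\<in>{F. finite F \<and> F \<subseteq> A}. \<Sum>a\<in>F. \<Sum>n. of_nat (count (B n) a))"
    by (rule ext)
  have "countable {F. finite F \<and> F \<subseteq> A}"
    by (rule countable_Collect_finite_subset) simp
  moreover have [measurable]:
      "(\<lambda>B :: nat \<Rightarrow> 's multiset. count (B n) a) \<in> measurable trajectory_space (count_space UNIV)" for n a
    by (rule measurable_compose[OF measurable_component_singleton]) auto
  ultimately show ?thesis
    unfolding eq by measurable
qed

end

theory Submission
  imports Defs
begin

text \<open>
  The comparison rests on the one-step equation for hitting probabilities. The probability \<open>u n
  m x\<close> that the process from \<open>x\<close> has no particle in \<open>A\<close> during the times \<open>n, ..., m\<close> is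
  obtained by iterating \<open>u \<mapsto> pgf \<mu> (\<integral> u d(P x))\<close>, with a factor \<open>0\<close> at the points of \<open>A\<close> from
  time \<open>n\<close> on (\<open>prob_avoids_until\<close>). If \<open>pgf \<nu> \<le> pgf \<mu>\<close> held on all of \<open>[0,1]\<close>, induction on
  \<open>m\<close> would give that avoiding \<open>A\<close> is less likely for \<open>\<nu>\<close>. The germ order gives this only near
  \<open>1\<close>, that is, when the hitting probabilities are small. Convexity of generating functions
  makes up for this: shrinking every \<open>\<mu>\<close>-hitting probability by one small constant \<open>c > 0\<close>
  moves it into the range where the two generating functions compare, and a shrunken solution
  of the \<open>\<mu>\<close>-equation is a subsolution of the same equation. Hence every \<open>\<nu>\<close>-hitting
  probability is at least \<open>c\<close> times the \<open>\<mu>\<close>-hitting probability (\<open>path_functional_comparison\<close>).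
  Letting \<open>m\<close> and then \<open>n\<close> tend to infinity, the probability of infinitely many visits under
  \<open>\<nu>\<close> is at least \<open>c\<close> times that under \<open>\<mu>\<close> (\<open>prob_finite_visits_comparison\<close>), which settles
  transience.

  For recurrence, let \<open>A\<close> be \<open>\<mu>\<close>-recurrent. The survival probability does not depend on the
  starting point, so the comparison bounds the \<open>\<nu>\<close>-probability \<open>w x\<close> of finitely many visits by
  a constant below \<open>1\<close>. The one-step equation gives \<open>W \<le> pgf \<nu> W\<close> for \<open>W = sup w < 1\<close>, and as
  \<open>\<nu>\<close> is supercritical, strict convexity forces \<open>W\<close> to be at most the extinction probability
  (\<open>supersolution_le_fixed_point\<close>, \<open>infinite_visits_of_uniform_bound\<close>). Extinction already
  accounts for that much probability of finitely many visits, so on survival there are almost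
  surely infinitely many.
\<close>

section \<open>Generating functions\<close>

lemma integrable_power_pmf:
  assumes "t \<in> {0..1::real}"
  shows "integrable (measure_pmf \<mu>) (\<lambda>n::nat. t ^ n)"
  using assms by (intro measure_pmf.integrable_const_bound[where B = 1]) (auto simp: power_le_one)

lemma pgf_in_unit_interval:
  assumes "t \<in> {0..1}"
  shows "pgf \<mu> t \<in> {0..1}"
  using assms unfolding pgf_def
  by (auto intro!: integral_nonneg measure_pmf.integral_le_const integrable_power_pmf power_le_one)

lemma pgf_mono:
  assumes "0 \<le> s" "s \<le> t" "t \<le> 1"
  shows "pgf \<mu> s \<le> pgf \<mu> t"
  using assms unfolding pgf_def
  by (auto intro!: integral_mono integrable_power_pmf power_mono)

lemma pgf_tendsto:
  assumes "\<And>n. t n \<in> {0..1}" "t \<longlonglongrightarrow> l"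
  shows "(\<lambda>n. pgf \<mu> (t n)) \<longlonglongrightarrow> pgf \<mu> l"
  unfolding pgf_def
  using assms
  by (intro integral_dominated_convergence[where w = "\<lambda>_. 1"])
     (auto simp: power_le_one intro!: tendsto_intros)

text \<open>
  Along the segment from \<open>x\<close> to \<open>1\<close> the powers from the square onwards lie below their chord by
  at least as much as the square does. A gap that does not depend on the exponent gives
  convexity and strict convexity of generating functions at once.
\<close>

lemma power_convex_gap:
  fixes c x :: real
  assumes "0 \<le> c" "c \<le> 1" "0 \<le> x" "x \<le> 1"
  shows "c * (1 - c) * (1 - x)\<^sup>2 \<le> c * x ^ (n + 2) + (1 - c) - (c * x + (1 - c)) ^ (n + 2)"
proof (induction n)
  case 0
  show ?case by (simp add: power2_eq_square algebra_simps)
next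
  case (Suc n)
  let ?a = "c * x + (1 - c)"
  have a: "0 \<le> ?a" "?a \<le> 1"
    using assms mult_left_mono[of x 1 c] by auto
  have *: "c * x ^ (Suc n + 2) + (1 - c) = ?a * (c * x ^ (n + 2) + (1 - c)) + c * (1 - c) * (1 - x) * (1 - x ^ (n + 2))"
    by (simp add: algebra_simps)
  have x: "x ^ (n + 2) \<le> x"
    using power_decreasing[of 1 "n + 2" x] assms by simp
  have "c * (1 - c) * (1 - x)\<^sup>2 = c * (1 - c) * (1 - x) * (1 - x)"
    by (simp add: power2_eq_square)
  also have "\<dots> \<le> c * (1 - c) * (1 - x) * (1 - x ^ (n + 2))"
    using assms x by (intro mult_left_mono) auto
  also have "\<dots> = c * x ^ (Suc n + 2) + (1 - c) - ?a * (c * x ^ (n + 2) + (1 - c))"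
    using * by linarith
  also have "\<dots> \<le> c * x ^ (Suc n + 2) + (1 - c) - ?a * ?a ^ (n + 2)"
  proof -
    have "0 \<le> c * (1 - c) * (1 - x)\<^sup>2" using assms by simp
    then have "?a ^ (n + 2) \<le> c * x ^ (n + 2) + (1 - c)" using Suc.IH by linarith
    then show ?thesis using a by (intro diff_left_mono mult_left_mono)
  qed
  finally show ?case by simp
qed

lemma power_convex_to_one:
  fixes c x :: real
  assumes "0 \<le> c" "c \<le> 1" "0 \<le> x" "x \<le> 1"
  shows "(c * x + (1 - c)) ^ n \<le> c * x ^ n + (1 - c)"
proof (cases "n < 2")
  case True
  then have "n = 0 \<or> n = 1" by auto
  then show ?thesis by auto
next
  case False
  then obtain k where "n = k + 2" by (metis add.commute le_Suc_ex not_less)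
  moreover have "0 \<le> c * (1 - c) * (1 - x)\<^sup>2" using assms by simp
  ultimately show ?thesis using power_convex_gap[OF assms, of k] by (metis diff_ge_0_iff_ge order_trans)
qed

lemma pgf_convex_to_one:
  assumes "0 \<le> c" "c \<le> 1" "0 \<le> x" "x \<le> 1"
  shows "pgf \<mu> (c * x + (1 - c)) \<le> c * pgf \<mu> x + (1 - c)"
proof -
  have "c * x + (1 - c) \<in> {0..1}" using assms mult_left_mono[of x 1 c] by auto
  then have "pgf \<mu> (c * x + (1 - c)) \<le> (\<integral>n. c * x ^ n + (1 - c) \<partial>measure_pmf \<mu>)"
    unfolding pgf_def using assms
    by (intro integral_mono integrable_power_pmf power_convex_to_one)
       (auto intro!: Bochner_Integration.integrable_add integrable_mult_right integrable_power_pmf)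
  also have "\<dots> = c * pgf \<mu> x + (1 - c)"
    using assms by (simp add: pgf_def integrable_power_pmf)
  finally show ?thesis .
qed

text \<open>
  Without two or more children the mean would be at most \<open>1\<close>. This is how supercriticality
  enters: it makes the generating function strictly convex.
\<close>

lemma supercritical_imp_branches:
  assumes "supercritical \<mu>"
  shows "\<exists>n\<ge>2. pmf \<mu> n > 0"
proof (rule ccontr)
  assume "\<not> ?thesis"
  then have small: "n \<le> 1" if "n \<in> set_pmf \<mu>" for n
    using that by (metis not_less_eq_eq one_add_one plus_1_eq_Suc pmf_positive)
  have "offspring_mean \<mu> \<le> (\<integral>\<^sup>+ n. 1 \<partial>measure_pmf \<mu>)"
    unfolding offspring_mean_def using small
    by (intro nn_integral_mono_AE) (force simp: AE_measure_pmf_iff)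
  then show False using assms by (simp add: supercritical_def measure_pmf.emeasure_space_1)
qed

lemma pgf_strictly_convex_to_one:
  assumes "supercritical \<mu>" "0 < c" "c < 1" "0 \<le> x" "x < 1"
  shows "pgf \<mu> (c * x + (1 - c)) < c * pgf \<mu> x + (1 - c)"
proof -
  from supercritical_imp_branches[OF assms(1)] obtain n where n: "n \<ge> 2" "pmf \<mu> n > 0" by blast
  let ?a = "c * x + (1 - c)"
  have a: "?a \<in> {0..1}" using assms mult_left_mono[of x 1 c] by auto
  define h where "h = (\<lambda>k::nat. c * x ^ k + (1 - c) - ?a ^ k)"
  have int: "integrable (measure_pmf \<mu>) h"
    unfolding h_def using assms a
    by (intro Bochner_Integration.integrable_add Bochner_Integration.integrable_diff
        integrable_mult_right integrable_power_pmf) auto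
  have h: "0 \<le> h k" for k using power_convex_to_one[of c x k] assms by (simp add: h_def)
  obtain k where k: "n = k + 2" using n by (metis add.commute le_Suc_ex)
  have "0 < c * (1 - c) * (1 - x)\<^sup>2" using assms by simp
  then have "0 < h n" using power_convex_gap[of c x k] assms unfolding h_def k by linarith
  then have "0 < (\<integral>k. h n * indicator {n} k \<partial>measure_pmf \<mu>)"
    using n by (simp add: measure_pmf_single)
  also have "\<dots> \<le> (\<integral>k. h k \<partial>measure_pmf \<mu>)"
    using h int by (intro integral_mono integrable_mult_right integrable_real_indicator)
      (auto split: split_indicator simp: measure_pmf.emeasure_eq_measure)
  also have "\<dots> = c * pgf \<mu> x + (1 - c) - pgf \<mu> ?a"
    using assms a by (simp add: h_def pgf_def integrable_power_pmf)
  finally show ?thesis by simp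
qed

text \<open>
  Otherwise \<open>W\<close> would lie strictly between \<open>e\<close> and \<open>1\<close>; the chord of the generating function
  over \<open>[e, 1]\<close> lies on or below the diagonal, and by strict convexity \<open>pgf \<mu> W\<close> lies strictly
  below this chord.
\<close>

lemma supersolution_le_fixed_point:
  assumes "supercritical \<mu>" "0 \<le> e" "pgf \<mu> e \<le> e" "W < 1" "W \<le> pgf \<mu> W"
  shows "W \<le> e"
proof (rule ccontr)
  assume "\<not> W \<le> e"
  then have "e < W" by simp
  define c where "c = (1 - W) / (1 - e)"
  have c: "0 < c" "c < 1" and "c * (1 - e) = 1 - W"
    using \<open>e < W\<close> assms(4) by (auto simp: c_def)
  then have W: "W = c * e + (1 - c)" by (simp add: algebra_simps)
  have "pgf \<mu> W < c * pgf \<mu> e + (1 - c)"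
    using pgf_strictly_convex_to_one[OF assms(1) c, of e] W assms \<open>e < W\<close> by simp
  also have "\<dots> \<le> c * e + (1 - c)" using c assms by simp
  finally show False using W assms(5) by simp
qed

section \<open>Independence\<close>

lemma indep_vars_PiM_coordinates:
  assumes "\<And>i. i \<in> I \<Longrightarrow> prob_space (M i)" "I \<noteq> {}"
  shows "prob_space.indep_vars (PiM I M) M (\<lambda>i \<omega>. \<omega> i) I"
proof -
  interpret prob_space "PiM I M" using assms by (intro prob_space_PiM)
  \<comment> \<open>Independence says that the joint law is the product of the marginal laws; here both are \<open>PiM I M\<close>.\<close>
  have "distr (PiM I M) (PiM I M) (\<lambda>\<omega>. \<lambda>i\<in>I. \<omega> i) = distr (PiM I M) (PiM I M) (\<lambda>\<omega>. \<omega>)"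
    by (intro distr_cong) (auto simp: space_PiM PiE_restrict)
  moreover have "PiM I (\<lambda>i. distr (PiM I M) (M i) (\<lambda>\<omega>. \<omega> i)) = PiM I M"
    using assms by (intro PiM_cong distr_PiM_component) auto
  ultimately show ?thesis
    using assms by (subst indep_vars_iff_distr_eq_PiM') auto
qed

lemma integral_PiM_prod:
  fixes g :: "'i \<Rightarrow> 'a \<Rightarrow> real"
  assumes "\<And>i. i \<in> I \<Longrightarrow> prob_space (M i)" and J: "finite J" "J \<subseteq> I"
    and g: "\<And>i. i \<in> J \<Longrightarrow> g i \<in> borel_measurable (M i)" "\<And>i r. i \<in> J \<Longrightarrow> \<bar>g i r\<bar> \<le> 1"
  shows "(\<integral>\<omega>. (\<Prod>i\<in>J. g i (\<omega> i)) \<partial>PiM I M) = (\<Prod>i\<in>J. \<integral>r. g i r \<partial>M i)"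
proof (cases "I = {}")
  case True
  interpret E: prob_space "PiM I M" using assms by (intro prob_space_PiM)
  from True J show ?thesis using E.prob_space by simp
next
  case False
  interpret prob_space "PiM I M" using assms by (intro prob_space_PiM)
  have meas: "(\<lambda>\<omega>. g i (\<omega> i)) \<in> borel_measurable (PiM I M)" if "i \<in> J" for i
    using that J
    by (intro measurable_compose[where N = "M i" and g = "g i", OF _ g(1)[OF that]] measurable_component_singleton) auto
  have "indep_vars (\<lambda>_. borel) (\<lambda>i \<omega>. g i (\<omega> i)) J"
    using assms(1) False g(1)
    by (intro indep_vars_compose2[OF indep_vars_subset[OF indep_vars_PiM_coordinates J(2)]]) auto
  then have "(\<integral>\<omega>. (\<Prod>i\<in>J. g i (\<omega> i)) \<partial>PiM I M) = (\<Prod>i\<in>J. \<integral>\<omega>. g i (\<omega> i) \<partial>PiM I M)"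
    using J(1) g meas
    by (intro indep_vars_lebesgue_integral) (auto intro!: integrable_const_bound[where B = 1])
  also have "\<dots> = (\<Prod>i\<in>J. \<integral>r. g i r \<partial>M i)"
  proof (intro prod.cong refl)
    fix i assume i: "i \<in> J"
    then have iI: "i \<in> I" using J by auto
    have "(\<integral>r. g i r \<partial>M i) = (\<integral>r. g i r \<partial>distr (PiM I M) (M i) (\<lambda>\<omega>. \<omega> i))"
      using distr_PiM_component[of I M i] assms(1) iI by simp
    also have "\<dots> = (\<integral>\<omega>. g i (\<omega> i) \<partial>PiM I M)"
      using i iI g(1) by (intro integral_distr) auto
    finally show "(\<integral>\<omega>. g i (\<omega> i) \<partial>PiM I M) = (\<integral>r. g i r \<partial>M i)" by simp
  qed
  finally show ?thesis .
qed

section \<open>The branching property\<close>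

lemma prod_mset_sum:
  fixes f :: "'s \<Rightarrow> real"
  shows "(\<Prod>y\<in>#(\<Sum>i\<in>I. B i). f y) = (\<Prod>i\<in>I. \<Prod>y\<in>#B i. f y)"
  by (induction I rule: infinite_finite_induct) auto

lemma prod_mset_unit_interval:
  fixes f :: "'s \<Rightarrow> real"
  assumes "\<And>y. f y \<in> {0..1}"
  shows "(\<Prod>y\<in>#b. f y) \<in> {0..1}"
  using assms by (induction b) (auto intro: mult_le_one)

definition generation_step :: "('s \<Rightarrow> 's pmf) \<Rightarrow> nat pmf \<Rightarrow> ('s \<Rightarrow> real) \<Rightarrow> 's \<Rightarrow> real" where
  "generation_step P \<mu> f x = pgf \<mu> (\<integral>y. f y \<partial>measure_pmf (P x))"

lemma pmf_expectation_unit_interval: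
  assumes "\<And>y. f y \<in> {0..1::real}"
  shows "(\<integral>y. f y \<partial>measure_pmf p) \<in> {0..1}"
  using assms
  by (auto intro!: integral_nonneg measure_pmf.integral_le_const measure_pmf.integrable_const_bound[where B = 1])

lemma generation_step_unit_interval:
  assumes "\<And>y. f y \<in> {0..1}"
  shows "generation_step P \<mu> f x \<in> {0..1}"
  unfolding generation_step_def by (intro pgf_in_unit_interval pmf_expectation_unit_interval assms)

lemma integral_children:
  fixes P :: "'s::countable \<Rightarrow> 's pmf"
  assumes f: "\<And>y. f y \<in> {0..1}"
  shows "(\<integral>r. (\<Prod>y\<in>#children r. f y) \<partial>reproduction_law P \<mu> x) = generation_step P \<mu> f x"
proof -
  let ?N = "\<Pi>\<^sub>M j\<in>(UNIV :: nat set). measure_pmf (P x)"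
  interpret J: product_prob_space "\<lambda>_. measure_pmf (P x)" "UNIV :: nat set" ..
  interpret pair_prob_space "measure_pmf \<mu>" ?N ..
  interpret R: prob_space "reproduction_law P \<mu> x" by (rule prob_space_reproduction_law)
  have "(\<lambda>r. \<Prod>y\<in>#children r. f y) \<in> borel_measurable (reproduction_law P \<mu> x)"
    by (rule measurable_compose[OF measurable_children]) simp
  then have int: "integrable (reproduction_law P \<mu> x) (\<lambda>r. \<Prod>y\<in>#children r. f y)"
    using prod_mset_unit_interval[of f, OF f] by (intro R.integrable_const_bound[where B = 1]) auto
  have "(\<integral>r. (\<Prod>y\<in>#children r. f y) \<partial>reproduction_law P \<mu> x)
      = (\<integral>n. \<integral>s. (\<Prod>y\<in>#children (n, s). f y) \<partial>?N \<partial>measure_pmf \<mu>)"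
    using integral_fst'[OF int[unfolded reproduction_law_def]] by (simp add: reproduction_law_def)
  also have "\<dots> = (\<integral>n. \<integral>s. (\<Prod>j<n. f (s j)) \<partial>?N \<partial>measure_pmf \<mu>)"
    by (simp add: children_def prod_mset_sum)
  also have "\<dots> = (\<integral>n. (\<integral>y. f y \<partial>measure_pmf (P x)) ^ n \<partial>measure_pmf \<mu>)"
    using f by (subst integral_PiM_prod) (auto simp: prob_space_measure_pmf)
  finally show ?thesis by (simp add: generation_step_def pgf_def)
qed


text \<open>
  The recursion step of the branching process, with the configuration detached from the noise,
  so that the configuration may be held fixed while the noise is integrated out.
\<close>

definition next_generation :: "nat \<Rightarrow> 's multiset \<Rightarrow> (nat \<times> 's \<times> nat \<Rightarrow> 's reproduction) \<Rightarrow> 's multiset" where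
  "next_generation n b \<omega> = (\<Sum>y\<in>set_mset b. \<Sum>i<count b y. children (\<omega> (n, y, i)))"

lemma branching_Suc_eq: "branching x \<omega> (Suc n) = next_generation n (branching x \<omega> n) \<omega>"
  by (simp add: next_generation_def)

lemma next_generation_cong:
  assumes "\<And>y i. \<omega> (n, y, i) = \<omega>' (n, y, i)"
  shows "next_generation n b \<omega> = next_generation n b \<omega>'"
  using assms by (simp add: next_generation_def)

lemma branching_cong:
  assumes "\<And>k y i. k < n \<Longrightarrow> \<omega> (k, y, i) = \<omega>' (k, y, i)"
  shows "branching x \<omega> n = branching x \<omega>' n"
  using assms
proof (induction n)
  case (Suc n)
  then have "branching x \<omega> n = branching x \<omega>' n" by simp
  moreover have "next_generation n b \<omega> = next_generation n b \<omega>'" for b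
    using Suc.prems by (intro next_generation_cong) auto
  ultimately show ?case unfolding branching_Suc_eq by simp
qed simp

text \<open>
  The particles of a fixed configuration use distinct, hence independent, coordinates of the
  noise. So a product over the next generation integrates to a product over the present one:
  this is the branching property.
\<close>

lemma integral_next_generation:
  fixes P :: "'s::countable \<Rightarrow> 's pmf"
  assumes f: "\<And>y. f y \<in> {0..1}"
  shows "(\<integral>\<omega>. (\<Prod>z\<in>#next_generation n b \<omega>. f z) \<partial>noise P \<mu>)
       = (\<Prod>y\<in>#b. generation_step P \<mu> f y)"
proof -
  let ?M = "\<lambda>(n, y, i). reproduction_law P \<mu> y"
  let ?J = "(\<lambda>(y, i). (n, y, i)) ` (SIGMA y : set_mset b. {..<count b y})"
  have inj: "inj_on (\<lambda>(y, i). (n, y, i)) (SIGMA y : set_mset b. {..<count b y})"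
    by (auto simp: inj_on_def)
  have "(\<integral>\<omega>. (\<Prod>z\<in>#next_generation n b \<omega>. f z) \<partial>noise P \<mu>)
      = (\<integral>\<omega>. (\<Prod>j\<in>?J. \<Prod>z\<in>#children (\<omega> j). f z) \<partial>noise P \<mu>)"
    by (subst prod.reindex[OF inj]) (simp add: next_generation_def prod_mset_sum prod.Sigma split_def)
  also have "\<dots> = (\<Prod>j\<in>?J. \<integral>r. (\<Prod>z\<in>#children r. f z) \<partial>?M j)"
    unfolding noise_def
  proof (rule integral_PiM_prod)
    show "prob_space (?M j)" for j :: "nat \<times> 's \<times> nat" by (auto simp: prob_space_reproduction_law split: prod.split)
    show "(\<lambda>r. \<Prod>z\<in>#children r. f z) \<in> borel_measurable (?M j)" for j :: "nat \<times> 's \<times> nat"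
      by (cases j) (auto intro!: measurable_compose[OF measurable_children])
    show "\<bar>\<Prod>z\<in>#children r. f z\<bar> \<le> 1" for r
      using prod_mset_unit_interval[of f "children r", OF f] by simp
  qed auto
  also have "\<dots> = (\<Prod>y\<in>set_mset b. \<Prod>i<count b y. generation_step P \<mu> f y)"
    by (subst prod.reindex[OF inj])
       (simp add: prod.Sigma split_def integral_children[OF f] del: prod_constant)
  also have "\<dots> = (\<Prod>y\<in>#b. generation_step P \<mu> f y)"
    by (simp add: image_prod_mset_multiplicity)
  finally show ?thesis .
qed

text \<open>
  The Markov property, in the form needed: the generations up to \<open>m\<close> depend only on the noise
  at times before \<open>m\<close>, and the step from generation \<open>m\<close> to \<open>m + 1\<close> only on the noise at time
  \<open>m\<close>. These two parts of the noise are independent, so the latter can be integrated out by the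
  branching property with generation \<open>m\<close> held fixed.
\<close>

lemma integral_last_generation:
  fixes P :: "'s::countable \<Rightarrow> 's pmf"
  assumes f: "\<And>y. f y \<in> {0..1}" and g: "\<And>k y. g k y \<in> {0..1}"
  shows "(\<integral>\<omega>. (\<Prod>k\<le>m. \<Prod>y\<in>#branching x \<omega> k. g k y) * (\<Prod>y\<in>#branching x \<omega> (Suc m). f y) \<partial>noise P \<mu>)
       = (\<integral>\<omega>. (\<Prod>k\<le>m. \<Prod>y\<in>#branching x \<omega> k. g k y) *
              (\<Prod>y\<in>#branching x \<omega> m. generation_step P \<mu> f y) \<partial>noise P \<mu>)"
proof -
  let ?N = "noise P \<mu>"
  let ?M = "\<lambda>(n :: nat, y, i :: nat). reproduction_law P \<mu> y"
  define past where "past = {(n :: nat, y :: 's, i :: nat). n < m}"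
  define present where "present = {(n :: nat, y :: 's, i :: nat). n = m}"
  interpret N: prob_space ?N by (rule prob_space_noise)
  have M: "prob_space (?M j)" for j :: "nat \<times> 's \<times> nat" by (auto simp: prob_space_reproduction_law split: prod.split)
  let ?S = "PiM past ?M" and ?T = "PiM present ?M"
  let ?X = "\<lambda>\<omega>. restrict \<omega> past" and ?Y = "\<lambda>\<omega>. restrict \<omega> present"
  have XY: "N.indep_var ?S ?X ?T ?Y"
    using N.indep_var_restrict[of ?M "\<lambda>i \<omega>. \<omega> i" UNIV past present] indep_vars_PiM_coordinates[of UNIV ?M] M
    by (auto simp: noise_def past_def present_def)
  have X[measurable]: "?X \<in> measurable ?N ?S" and Y[measurable]: "?Y \<in> measurable ?N ?T"
    unfolding noise_def by measurable

  obtain \<omega>0 where \<omega>0: "\<omega>0 \<in> space ?N" using N.not_empty by blast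
  \<comment> \<open>The process is a function of the whole noise. To see its past as a function of the past noise,
    the remaining coordinates are filled with the arbitrary admissible values \<open>\<omega>0\<close>.\<close>
  define extend where "extend = (\<lambda>p i. if i \<in> past then p i else \<omega>0 i)"
  have extend: "extend \<in> measurable ?S ?N"
    unfolding noise_def
  proof (rule measurable_PiM_single')
    show comp: "(\<lambda>p. extend p i) \<in> measurable ?S (?M i)" for i
    proof (cases "i \<in> past")
      case True
      then show ?thesis by (simp add: extend_def)
    next
      case False
      have "\<omega>0 i \<in> space (?M i)" using \<omega>0 by (cases i) (auto simp: noise_def space_PiM PiE_iff)
      with False show ?thesis by (simp add: extend_def)
    qed
    show "extend \<in> space ?S \<rightarrow> (\<Pi>\<^sub>E i\<in>UNIV. space (?M i))"
      using measurable_space[OF comp] by (simp add: PiE_iff)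
  qed
  have extend_X: "branching x (extend (?X \<omega>)) k = branching x \<omega> k" if "k \<le> m" for \<omega> k
    using that by (intro branching_cong) (auto simp: extend_def past_def)
  have next_Y: "next_generation m b (?Y \<omega>) = next_generation m b \<omega>" for b \<omega>
    by (intro next_generation_cong) (auto simp: present_def)

  have B[measurable]: "(\<lambda>p. branching x (extend p) k) \<in> measurable ?S (count_space UNIV)" for k
    by (rule measurable_compose[OF extend measurable_branching_component])
  have G[measurable]: "next_generation m b \<in> measurable ?T (count_space UNIV)" for b
    unfolding next_generation_def
  proof (intro measurable_multiset_sum finite_set_mset finite_lessThan)
    fix y i
    have "(\<lambda>q. q (m, y, i)) \<in> measurable ?T (?M (m, y, i))"
      by (rule measurable_component_singleton) (simp add: present_def)
    then show "(\<lambda>q. children (q (m, y, i))) \<in> measurable ?T (count_space UNIV)"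
      by (intro measurable_compose[OF _ measurable_children[of P \<mu> y]]) simp
  qed
  define Z where "Z = (\<lambda>p. \<Prod>k\<le>m. \<Prod>y\<in>#branching x (extend p) k. g k y)"
  define H where "H = (\<lambda>pq. Z (fst pq) *
    (\<Prod>z\<in>#next_generation m (branching x (extend (fst pq)) m) (snd pq). f z))"
  have Z[measurable]: "Z \<in> borel_measurable ?S"
    unfolding Z_def by (intro borel_measurable_prod measurable_compose[OF B]) simp
  have next_meas: "(\<lambda>pq. next_generation m (branching x (extend (fst pq)) m) (snd pq))
      \<in> measurable (?S \<Otimes>\<^sub>M ?T) (count_space UNIV)"
    by (rule measurable_compose_countable'[OF _ _ countable_UNIV_multiset,
          where f = "\<lambda>b pq. next_generation m b (snd pq)"]) measurable
  have H[measurable]: "H \<in> borel_measurable (?S \<Otimes>\<^sub>M ?T)"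
    unfolding H_def
    by (rule borel_measurable_times[OF measurable_compose[OF measurable_fst Z] measurable_compose[OF next_meas]]) simp
  have Z01: "Z p \<in> {0..1}" for p
    using prod_mset_unit_interval[of "g _", OF g] by (auto simp: Z_def intro!: prod_nonneg prod_le_1)
  have H01: "H pq \<in> {0..1}" for pq
    using prod_mset_unit_interval[of f, OF f] Z01 by (auto simp: H_def intro!: mult_le_one)

  interpret DX: prob_space "distr ?N ?S ?X" by (rule N.prob_space_distr) measurable
  interpret DY: prob_space "distr ?N ?T ?Y" by (rule N.prob_space_distr) measurable
  interpret D: pair_prob_space "distr ?N ?S ?X" "distr ?N ?T ?Y" ..
  have int: "integrable (distr ?N ?S ?X \<Otimes>\<^sub>M distr ?N ?T ?Y) H"
    using H01 by (intro D.integrable_const_bound[where B = 1]) auto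
  have "(\<integral>\<omega>. (\<Prod>k\<le>m. \<Prod>y\<in>#branching x \<omega> k. g k y) * (\<Prod>y\<in>#branching x \<omega> (Suc m). f y) \<partial>?N)
      = (\<integral>\<omega>. H (?X \<omega>, ?Y \<omega>) \<partial>?N)"
    unfolding branching_Suc_eq by (simp add: H_def Z_def extend_X next_Y)
  also have "\<dots> = (\<integral>pq. H pq \<partial>distr ?N (?S \<Otimes>\<^sub>M ?T) (\<lambda>\<omega>. (?X \<omega>, ?Y \<omega>)))"
    by (rule integral_distr[symmetric]) measurable
  also have "\<dots> = (\<integral>pq. H pq \<partial>(distr ?N ?S ?X \<Otimes>\<^sub>M distr ?N ?T ?Y))"
    using XY by (simp add: N.indep_var_distribution_eq)
  also have "\<dots> = (\<integral>p. \<integral>q. H (p, q) \<partial>distr ?N ?T ?Y \<partial>distr ?N ?S ?X)"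
    using D.integral_fst'[OF int] by simp
  also have "\<dots> = (\<integral>p. \<integral>\<omega>'. H (p, ?Y \<omega>') \<partial>?N \<partial>distr ?N ?S ?X)"
    by (intro Bochner_Integration.integral_cong refl integral_distr) (auto simp: space_distr)
  also have "\<dots> = (\<integral>\<omega>. \<integral>\<omega>'. H (?X \<omega>, ?Y \<omega>') \<partial>?N \<partial>?N)"
    by (intro integral_distr) measurable
  also have "\<dots> = (\<integral>\<omega>. (\<Prod>k\<le>m. \<Prod>y\<in>#branching x \<omega> k. g k y) *
              (\<Prod>y\<in>#branching x \<omega> m. generation_step P \<mu> f y) \<partial>?N)"
    by (simp add: H_def Z_def extend_X next_Y integral_next_generation[OF f])
  finally show ?thesis .
qed

text \<open>
  The expectation of \<open>\<Prod>k\<le>m. \<Prod>y\<in>#B k. f k y\<close> for the process started at \<open>x\<close>, computed by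
  conditioning on the first generation. It is defined for general weights \<open>f\<close>, and not only for
  indicators, because peeling off the last generation turns indicators into generating
  functions.
\<close>

primrec path_functional :: "('s \<Rightarrow> 's pmf) \<Rightarrow> nat pmf \<Rightarrow> nat \<Rightarrow> (nat \<Rightarrow> 's \<Rightarrow> real) \<Rightarrow> 's \<Rightarrow> real" where
  "path_functional P \<mu> 0 f x = f 0 x"
| "path_functional P \<mu> (Suc m) f x = f 0 x * generation_step P \<mu> (path_functional P \<mu> m (\<lambda>k. f (Suc k))) x"

lemma path_functional_unit_interval:
  assumes "\<And>k y. f k y \<in> {0..1}"
  shows "path_functional P \<mu> m f x \<in> {0..1}"
  using assms
proof (induction m arbitrary: f x)
  case (Suc m)
  have "generation_step P \<mu> (path_functional P \<mu> m (\<lambda>k. f (Suc k))) x \<in> {0..1}"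
    by (intro generation_step_unit_interval Suc.IH Suc.prems)
  with Suc.prems[of 0 x] show ?case by (simp add: mult_le_one)
qed simp

text \<open>
  The recursion runs along the first generation, whereas the Markov property is available for
  the last one. This reconciles the two: integrating out the last generation multiplies the
  weight of the one before.
\<close>

lemma path_functional_Suc_last:
  "path_functional P \<mu> (Suc m) f =
   path_functional P \<mu> m (f(m := \<lambda>y. f m y * generation_step P \<mu> (f (Suc m)) y))"
proof (induction m arbitrary: f)
  case 0
  have "path_functional P \<mu> 0 g = g 0" for g by (rule ext) simp
  then show ?case by (intro ext) simp
next
  case (Suc m)
  let ?h = "\<lambda>y. f (Suc m) y * generation_step P \<mu> (f (Suc (Suc m))) y"
  show ?case
  proof (rule ext)
    fix x
    have "(\<lambda>k. (f(Suc m := ?h)) (Suc k)) = (\<lambda>k. f (Suc k))(m := ?h)"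
      by (rule ext) simp
    then have "path_functional P \<mu> (Suc m) (f(Suc m := ?h)) x
        = f 0 x * generation_step P \<mu> (path_functional P \<mu> m ((\<lambda>k. f (Suc k))(m := ?h))) x"
      by (simp only: path_functional.simps(2)) simp
    also have "\<dots> = path_functional P \<mu> (Suc (Suc m)) f x"
      by (simp only: path_functional.simps(2)[of P \<mu> "Suc m"] Suc.IH)
    finally show "path_functional P \<mu> (Suc (Suc m)) f x = path_functional P \<mu> (Suc m) (f(Suc m := ?h)) x"
      by (rule sym)
  qed
qed

lemma expectation_branching_prod:
  fixes P :: "'s::countable \<Rightarrow> 's pmf"
  assumes "\<And>k y. f k y \<in> {0..1}"
  shows "(\<integral>B. (\<Prod>k\<le>m. \<Prod>y\<in>#B k. f k y) \<partial>branching_law P \<mu> x) = path_functional P \<mu> m f x"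
proof -
  interpret N: prob_space "noise P \<mu>" by (rule prob_space_noise)
  have "(\<integral>\<omega>. (\<Prod>k\<le>m. \<Prod>y\<in>#branching x \<omega> k. f k y) \<partial>noise P \<mu>) = path_functional P \<mu> m f x"
    using assms
  proof (induction m arbitrary: f)
    case 0
    show ?case by (simp add: N.prob_space)
  next
    case (Suc m)
    let ?f = "f(m := \<lambda>y. f m y * generation_step P \<mu> (f (Suc m)) y)"
    have step: "generation_step P \<mu> (f (Suc m)) y \<in> {0..1}" for y
      by (intro generation_step_unit_interval Suc.prems)
    have f: "?f k y \<in> {0..1}" for k y
      using Suc.prems[of k y] step[of y] Suc.prems[of m y] by (auto simp: mult_le_one)
    have "(\<integral>\<omega>. (\<Prod>k\<le>Suc m. \<Prod>y\<in>#branching x \<omega> k. f k y) \<partial>noise P \<mu>)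
        = (\<integral>\<omega>. (\<Prod>k\<le>m. \<Prod>y\<in>#branching x \<omega> k. f k y) *
              (\<Prod>y\<in>#branching x \<omega> m. generation_step P \<mu> (f (Suc m)) y) \<partial>noise P \<mu>)"
      using integral_last_generation[where f = "f (Suc m)" and g = f and m = m and x = x and P = P and \<mu> = \<mu>] Suc.prems 
      by (simp only: prod.atMost_Suc)
    also have "\<dots> = (\<integral>\<omega>. (\<Prod>k\<le>m. \<Prod>y\<in>#branching x \<omega> k. ?f k y) \<partial>noise P \<mu>)"
    proof (intro Bochner_Integration.integral_cong refl)
      fix \<omega>
      have "(\<Prod>k\<le>m. h k) = (\<Prod>k<m. h k) * h m" for h :: "nat \<Rightarrow> real"
        by (simp add: lessThan_Suc_atMost[symmetric])
      then show "(\<Prod>k\<le>m. \<Prod>y\<in>#branching x \<omega> k. f k y) *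
            (\<Prod>y\<in>#branching x \<omega> m. generation_step P \<mu> (f (Suc m)) y)
          = (\<Prod>k\<le>m. \<Prod>y\<in>#branching x \<omega> k. ?f k y)"
        by (simp add: prod_mset.distrib)
    qed
    also have "\<dots> = path_functional P \<mu> (Suc m) f x"
      unfolding path_functional_Suc_last by (rule Suc.IH) (rule f)
    finally show ?case .
  qed
  moreover have "(\<lambda>B. \<Prod>k\<le>m. \<Prod>y\<in>#B k. f k y) \<in> borel_measurable trajectory_space"
    by (intro borel_measurable_prod measurable_compose[OF measurable_component_singleton]) auto
  ultimately show ?thesis
    unfolding branching_law_def by (simp add: integral_distr[OF measurable_branching])
qed

section \<open>Visits and survival\<close>

text \<open>
  Each generation is finite, so infinitely many particles in \<open>A\<close> must be spread over infinitely
  many generations. Conversely, \<open>N\<close> generations that meet \<open>A\<close> contribute at least \<open>N\<close> to a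
  finite partial sum.
\<close>

lemma visits_eq_infinity_iff:
  "visits A B = \<infinity> \<longleftrightarrow> (\<forall>n. \<exists>k\<ge>n. set_mset (B k) \<inter> A \<noteq> {})"
proof
  assume inf: "visits A B = \<infinity>"
  show "\<forall>n. \<exists>k\<ge>n. set_mset (B k) \<inter> A \<noteq> {}"
  proof (rule ccontr)
    assume "\<not> ?thesis"
    then obtain n where n: "set_mset (B k) \<inter> A = {}" if "k \<ge> n" for k by blast
    let ?C = "\<Sum>k<n. of_nat (size (B k)) :: ennreal"
    have "(\<Sum>a\<in>F. \<Sum>k. of_nat (count (B k) a)) \<le> ?C" if F: "finite F" "F \<subseteq> A" for F
    proof -
      have zero: "count (B k) a = 0" if "k \<ge> n" "a \<in> F" for k a
        using n[OF that(1)] that(2) F(2) by (auto simp: count_eq_zero_iff)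
      have "(\<Sum>a\<in>F. \<Sum>k. of_nat (count (B k) a)) = (\<Sum>a\<in>F. \<Sum>k<n. of_nat (count (B k) a) :: ennreal)"
        using zero by (intro sum.cong refl suminf_finite) (auto simp: not_less)
      also have "\<dots> = (\<Sum>k<n. of_nat (\<Sum>a\<in>F. count (B k) a))"
        by (subst sum.swap) simp
      also have "\<dots> \<le> ?C"
      proof (intro sum_mono of_nat_mono)
        fix k
        have "(\<Sum>a\<in>F. count (B k) a) = (\<Sum>a\<in>F \<inter> set_mset (B k). count (B k) a)"
          using F(1) by (intro sum.mono_neutral_right) (auto simp: count_eq_zero_iff)
        also have "\<dots> \<le> (\<Sum>a\<in>set_mset (B k). count (B k) a)"
          by (intro sum_mono2) auto
        finally show "(\<Sum>a\<in>F. count (B k) a) \<le> size (B k)" by (simp add: size_multiset_overloaded_eq)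
      qed
      finally show ?thesis .
    qed
    then have "visits A B \<le> ?C"
      unfolding visits_def by (subst nonneg_infsum_complete) (auto intro!: SUP_least)
    also have "?C < \<infinity>" by (simp add: of_nat_less_top)
    finally show False using inf by simp
  qed
next
  assume io: "\<forall>n. \<exists>k\<ge>n. set_mset (B k) \<inter> A \<noteq> {}"
  have "of_nat N \<le> visits A B" for N
  proof -
    have "infinite {k. set_mset (B k) \<inter> A \<noteq> {}}"
      using io by (auto simp: infinite_nat_iff_unbounded_le)
    then obtain T where T: "finite T" "card T = N" "T \<subseteq> {k. set_mset (B k) \<inter> A \<noteq> {}}"
      using infinite_arbitrarily_large by blast
    then have "\<forall>k\<in>T. \<exists>a. a \<in> set_mset (B k) \<inter> A" by blast
    then obtain a where a: "a k \<in># B k" "a k \<in> A" if "k \<in> T" for k by (metis IntE)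
    let ?F = "a ` T"
    have F: "finite ?F" "?F \<subseteq> A" using T(1) a by auto
    have "1 \<le> (\<Sum>s\<in>?F. count (B k) s)" if "k \<in> T" for k
    proof -
      have "1 \<le> count (B k) (a k)" using a(1)[OF that] by (simp add: Suc_le_eq)
      also have "\<dots> \<le> (\<Sum>s\<in>?F. count (B k) s)" using that F(1) by (intro member_le_sum) auto
      finally show ?thesis .
    qed
    then have "card T \<le> (\<Sum>k\<in>T. \<Sum>s\<in>?F. count (B k) s)"
      using sum_mono[of T "\<lambda>_. 1 :: nat" "\<lambda>k. \<Sum>s\<in>?F. count (B k) s"] by simp
    then have "of_nat N \<le> (of_nat (\<Sum>k\<in>T. \<Sum>s\<in>?F. count (B k) s) :: ennreal)"
      using T(2) by (intro of_nat_mono) simp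
    also have "\<dots> = (\<Sum>s\<in>?F. \<Sum>k\<in>T. of_nat (count (B k) s))"
      by (subst sum.swap) simp
    also have "\<dots> \<le> (\<Sum>s\<in>?F. \<Sum>k. of_nat (count (B k) s))"
      using T(1) by (intro sum_mono sum_le_suminf) auto
    also have "\<dots> \<le> visits A B"
      unfolding visits_def using F by (subst nonneg_infsum_complete) (auto intro!: SUP_upper)
    finally show ?thesis .
  qed
  then show "visits A B = \<infinity>"
    by (metis ennreal_Ex_less_of_nat infinity_ennreal_def not_le top.not_eq_extremum)
qed

definition avoids :: "'s set \<Rightarrow> nat \<Rightarrow> (nat \<Rightarrow> 's multiset) set" where
  "avoids A n = {B. \<forall>k\<ge>n. set_mset (B k) \<inter> A = {}}"

lemma incseq_avoids: "incseq (avoids A)"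
  unfolding avoids_def by (intro incseq_SucI subsetI CollectI) (use Suc_leD in blast)

text \<open>
  Weights for which \<open>path_functional\<close> is the probability of avoiding \<open>A\<close> from time \<open>n\<close> up to the last time considered.
\<close>

definition avoidance :: "'s set \<Rightarrow> nat \<Rightarrow> nat \<Rightarrow> 's \<Rightarrow> real" where
  "avoidance A n k y = of_bool (n \<le> k \<longrightarrow> y \<notin> A)"

lemma avoidance_unit_interval: "avoidance A n k y \<in> {0..1}"
  by (simp add: avoidance_def)

lemma space_branching_law: "space (branching_law P \<mu> x) = UNIV"
  by (simp add: branching_law_def space_PiM)

lemma measurable_disjoint_component [measurable]:
  "Measurable.pred trajectory_space (\<lambda>B. set_mset (B k) \<inter> A = {})"
  by (rule measurable_compose[OF measurable_component_singleton]) auto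

lemma sets_avoids:
  "avoids A n \<in> sets (branching_law P \<mu> x)"
proof -
  have "{B \<in> space trajectory_space. \<forall>k\<ge>n. set_mset (B k) \<inter> A = {}} \<in> sets trajectory_space"
    by measurable
  then show ?thesis by (simp add: sets_branching_law avoids_def space_PiM)
qed

lemma prod_mset_of_bool:
  "(\<Prod>y\<in>#b. of_bool (Q y) :: real) = of_bool (\<forall>y\<in>#b. Q y)"
  by (induction b) auto

lemma prod_of_bool:
  "finite K \<Longrightarrow> (\<Prod>k\<in>K. of_bool (Q k) :: real) = of_bool (\<forall>k\<in>K. Q k)"
  by (induction K rule: finite_induct) auto

lemma prob_avoids_until:
  fixes P :: "'s::countable \<Rightarrow> 's pmf"
  shows "measure (branching_law P \<mu> x) {B. \<forall>k\<in>{n..m}. set_mset (B k) \<inter> A = {}}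
       = path_functional P \<mu> m (avoidance A n) x"
proof -
  let ?E = "{B. \<forall>k\<in>{n..m}. set_mset (B k) \<inter> A = {}}"
  have eq: "(\<Prod>k\<le>m. \<Prod>y\<in>#B k. avoidance A n k y) = indicator ?E B" for B
    by (auto simp: avoidance_def prod_mset_of_bool prod_of_bool indicator_def)
  have "(\<integral>B. (\<Prod>k\<le>m. \<Prod>y\<in>#B k. avoidance A n k y) \<partial>branching_law P \<mu> x)
      = measure (branching_law P \<mu> x) ?E"
    unfolding eq by (simp add: space_branching_law)
  then show ?thesis
    using expectation_branching_prod[of "avoidance A n", where m = m and P = P and \<mu> = \<mu> and x = x]
    by (simp add: avoidance_unit_interval[unfolded atLeastAtMost_iff])
qed

lemma path_functional_avoidance_Suc:
  "path_functional P \<mu> (Suc m) (avoidance A (Suc n)) x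
 = generation_step P \<mu> (path_functional P \<mu> m (avoidance A n)) x"
  by (simp add: avoidance_def[abs_def])

lemma path_functional_avoidance_tendsto:
  fixes P :: "'s::countable \<Rightarrow> 's pmf"
  shows "(\<lambda>m. path_functional P \<mu> m (avoidance A n) x) \<longlonglongrightarrow> measure (branching_law P \<mu> x) (avoids A n)"
proof -
  interpret prob_space "branching_law P \<mu> x" by (rule prob_space_branching_law)
  let ?E = "\<lambda>m. {B. \<forall>k\<in>{n..m}. set_mset (B k) \<inter> A = {}}"
  have "{B \<in> space trajectory_space. \<forall>k\<in>{n..m}. set_mset (B k) \<inter> A = {}} \<in> sets trajectory_space" for m
    by measurable
  then have "range ?E \<subseteq> events"
    by (auto simp: sets_branching_law space_PiM)
  moreover have "decseq ?E" by (intro decseq_SucI) auto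
  ultimately have "(\<lambda>m. prob (?E m)) \<longlonglongrightarrow> prob (\<Inter>m. ?E m)"
    by (rule finite_Lim_measure_decseq)
  moreover have "(\<Inter>m. ?E m) = avoids A n" unfolding avoids_def by fastforce
  ultimately show ?thesis by (simp add: prob_avoids_until)
qed

text \<open>
  The one-step equation survives the limit in the length of the time window, by dominated
  convergence.
\<close>

lemma prob_avoids_Suc:
  fixes P :: "'s::countable \<Rightarrow> 's pmf"
  shows "measure (branching_law P \<mu> x) (avoids A (Suc n))
       = generation_step P \<mu> (\<lambda>y. measure (branching_law P \<mu> y) (avoids A n)) x"
proof (rule LIMSEQ_unique)
  let ?u = "\<lambda>m. path_functional P \<mu> m (avoidance A n)"
  show "(\<lambda>m. path_functional P \<mu> (Suc m) (avoidance A (Suc n)) x)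
      \<longlonglongrightarrow> measure (branching_law P \<mu> x) (avoids A (Suc n))"
    by (rule LIMSEQ_Suc[OF path_functional_avoidance_tendsto])
  have u: "?u m y \<in> {0..1}" for m y
    by (intro path_functional_unit_interval avoidance_unit_interval)
  then have "(\<lambda>m. \<integral>y. ?u m y \<partial>measure_pmf (P x))
      \<longlonglongrightarrow> (\<integral>y. measure (branching_law P \<mu> y) (avoids A n) \<partial>measure_pmf (P x))"
    by (intro integral_dominated_convergence[where w = "\<lambda>_. 1"])
       (auto intro: path_functional_avoidance_tendsto)
  then show "(\<lambda>m. path_functional P \<mu> (Suc m) (avoidance A (Suc n)) x)
      \<longlonglongrightarrow> generation_step P \<mu> (\<lambda>y. measure (branching_law P \<mu> y) (avoids A n)) x"
    unfolding path_functional_avoidance_Suc unfolding generation_step_def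
    by (intro pgf_tendsto pmf_expectation_unit_interval u)
qed

lemma prob_avoids_tendsto:
  fixes P :: "'s::countable \<Rightarrow> 's pmf"
  shows "(\<lambda>n. measure (branching_law P \<mu> x) (avoids A n))
      \<longlonglongrightarrow> measure (branching_law P \<mu> x) {B. visits A B \<noteq> \<infinity>}"
proof -
  interpret prob_space "branching_law P \<mu> x" by (rule prob_space_branching_law)
  have "incseq (avoids A)" by (rule incseq_avoids)
  then have "(\<lambda>n. prob (avoids A n)) \<longlonglongrightarrow> prob (\<Union>n. avoids A n)"
    by (intro finite_Lim_measure_incseq) (auto simp: sets_avoids)
  moreover have "(\<Union>n. avoids A n) = {B. visits A B \<noteq> \<infinity>}"
    unfolding visits_eq_infinity_iff by (auto simp: avoids_def)
  ultimately show ?thesis by simp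
qed

lemma prob_avoids_le:
  fixes P :: "'s::countable \<Rightarrow> 's pmf"
  shows "measure (branching_law P \<mu> x) (avoids A n) \<le> measure (branching_law P \<mu> x) {B. visits A B \<noteq> \<infinity>}"
proof (rule incseq_le[OF _ prob_avoids_tendsto])
  interpret prob_space "branching_law P \<mu> x" by (rule prob_space_branching_law)
  show "incseq (\<lambda>n. prob (avoids A n))"
    by (intro incseq_SucI finite_measure_mono sets_avoids incseq_SucD[OF incseq_avoids])
qed

text \<open>
  On the space of all trajectories an empty configuration may be followed by particles; only
  under the law of the process is extinction final.
\<close>

lemma AE_extinction_absorbing:
  fixes P :: "'s::countable \<Rightarrow> 's pmf"
  shows "AE B in branching_law P \<mu> x. \<forall>n. B n = {#} \<longrightarrow> (\<forall>k\<ge>n. B k = {#})"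
proof -
  have [measurable]: "Measurable.pred trajectory_space (\<lambda>B. B n = {#})" for n
    by (rule measurable_compose[OF measurable_component_singleton]) auto
  have "branching x \<omega> k = {#}" if "branching x \<omega> n = {#}" "k \<ge> n" for \<omega> n k
    using that(2,1) by (induction rule: dec_induct) auto
  then have "AE \<omega> in noise P \<mu>. \<forall>n. branching x \<omega> n = {#} \<longrightarrow> (\<forall>k\<ge>n. branching x \<omega> k = {#})"
    by blast
  then show ?thesis
    unfolding branching_law_def by (subst AE_distr_iff[OF measurable_branching]) measurable
qed

text \<open>
  Avoiding all of \<open>UNIV\<close> at the single time \<open>n\<close> means being extinct by then, so extinction is a
  case of avoidance. The starting point drops out because the number of children does not
  depend on the position.
\<close>

lemma path_functional_extinction:
  "path_functional P \<mu> n (avoidance UNIV n) x = (pgf \<mu> ^^ n) 0"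
proof (induction n arbitrary: x)
  case (Suc n)
  then show ?case by (simp add: path_functional_avoidance_Suc generation_step_def del: path_functional.simps)
qed (simp add: avoidance_def)

lemma prob_survives:
  fixes P :: "'s::countable \<Rightarrow> 's pmf"
  shows "(\<lambda>n. 1 - (pgf \<mu> ^^ n) 0) \<longlonglongrightarrow> measure (branching_law P \<mu> x) {B. survives B}"
proof -
  interpret prob_space "branching_law P \<mu> x" by (rule prob_space_branching_law)
  have pred [measurable]: "Measurable.pred trajectory_space (\<lambda>B. B n = {#})" for n
    by (rule measurable_compose[OF measurable_component_singleton]) auto
  let ?E = "\<lambda>n. {B :: nat \<Rightarrow> 's multiset. \<forall>k\<le>n. B k \<noteq> {#}}"
  have "{B \<in> space trajectory_space. \<forall>k\<le>n. B k \<noteq> {#}} \<in> sets trajectory_space" for n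
    by measurable
  then have E: "?E n \<in> events" for n
    by (simp add: sets_branching_law space_PiM)
  have D: "{B. B n = {#}} \<in> events" for n
    using pred[of n, unfolded pred_def] by (simp add: sets_branching_law space_PiM)
  have "decseq ?E" by (intro decseq_SucI) auto
  with E have "(\<lambda>n. prob (?E n)) \<longlonglongrightarrow> prob (\<Inter>n. ?E n)"
    by (intro finite_Lim_measure_decseq) auto
  moreover have "(\<Inter>n. ?E n) = {B. survives B}"
    by (force simp: survives_def nonempty_has_size)
  moreover have "prob (?E n) = 1 - (pgf \<mu> ^^ n) 0" for n
  proof -
    have "prob (?E n) = prob (space (branching_law P \<mu> x) - {B. B n = {#}})"
      using AE_extinction_absorbing[of P \<mu> x]
      by (intro finite_measure_eq_AE E sets.compl_sets D) (auto simp: space_branching_law)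
    also have "\<dots> = 1 - prob {B. B n = {#}}" by (rule prob_compl[OF D])
    also have "prob {B. B n = {#}} = (pgf \<mu> ^^ n) 0"
      using prob_avoids_until[of P \<mu> x n n UNIV] by (simp add: path_functional_extinction)
    finally show ?thesis .
  qed
  ultimately show ?thesis by (simp only:)
qed

section \<open>Comparison of the two processes\<close>

text \<open>
  In terms of \<open>s = 1 - t\<close>, the argument \<open>c * t + (1 - c)\<close> is \<open>1 - c * s\<close>: hitting probabilities
  are multiplied by \<open>c\<close>. With \<open>c \<le> \<epsilon>\<close> every such argument lies where the germ order applies,
  and convexity of \<open>pgf \<mu>\<close> towards its value \<open>1\<close> at \<open>1\<close> extracts the factor \<open>c\<close>.
\<close>

lemma germ_le_imp_pgf_comparison:
  assumes "germ_le \<mu> \<nu>"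
  shows "\<exists>c>0. c \<le> 1 \<and> (\<forall>t\<in>{0..1}. pgf \<nu> (c * t + (1 - c)) \<le> c * pgf \<mu> t + (1 - c))"
proof -
  from assms obtain \<epsilon> where \<epsilon>: "\<epsilon> > 0"
    "\<And>t. t \<in> {0..1} \<Longrightarrow> 1 - \<epsilon> \<le> t \<Longrightarrow> pgf \<nu> t \<le> pgf \<mu> t"
    unfolding germ_le_def by blast
  define c where "c = min \<epsilon> 1"
  have c: "c > 0" "c \<le> 1" "c \<le> \<epsilon>" using \<epsilon> by (auto simp: c_def)
  moreover have "pgf \<nu> (c * t + (1 - c)) \<le> c * pgf \<mu> t + (1 - c)" if t: "t \<in> {0..1}" for t
  proof -
    have "c * t \<le> c" "0 \<le> c * t" using c t by (auto intro: mult_left_le)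
    then have "pgf \<nu> (c * t + (1 - c)) \<le> pgf \<mu> (c * t + (1 - c))"
      using c by (intro \<epsilon>(2)) auto
    also have "\<dots> \<le> c * pgf \<mu> t + (1 - c)"
      using c t by (intro pgf_convex_to_one) auto
    finally show ?thesis .
  qed
  ultimately show ?thesis by blast
qed

text \<open>
  For \<open>g \<rho> = 1 - path_functional P \<rho> m f x\<close> the claim reads \<open>c * g \<mu> \<le> g \<nu>\<close>. The hypothesis on
  the generating functions propagates it through each generation; weights in \<open>[0,1]\<close> preserve
  it.
\<close>

lemma path_functional_comparison:
  assumes c: "0 < c" "c \<le> 1"
    and G: "\<And>t. t \<in> {0..1} \<Longrightarrow> pgf \<nu> (c * t + (1 - c)) \<le> c * pgf \<mu> t + (1 - c)"
    and f: "\<And>k y. f k y \<in> {0..1}"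
  shows "path_functional P \<nu> m f x \<le> c * path_functional P \<mu> m f x + (1 - c)"
  using f
proof (induction m arbitrary: f x)
  case 0
  have "(1 - c) * f 0 x \<le> 1 - c" using c 0[of 0 x] by (intro mult_left_le) auto
  then show ?case by (simp add: algebra_simps)
next
  case (Suc m)
  let ?u = "\<lambda>\<rho>. path_functional P \<rho> m (\<lambda>k. f (Suc k))"
  let ?E = "\<lambda>g. \<integral>y. g y \<partial>measure_pmf (P x)"
  have u: "?u \<rho> y \<in> {0..1}" for \<rho> y
    by (intro path_functional_unit_interval Suc.prems)
  have int: "integrable (measure_pmf (P x)) (?u \<rho>)" for \<rho>
    using u by (intro measure_pmf.integrable_const_bound[where B = 1]) auto
  have E: "?E (?u \<rho>) \<in> {0..1}" for \<rho>
    by (intro pmf_expectation_unit_interval u)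
  have "?E (?u \<nu>) \<le> ?E (\<lambda>y. c * ?u \<mu> y + (1 - c))"
    by (intro integral_mono Suc.IH Suc.prems int Bochner_Integration.integrable_add integrable_mult_right) auto
  also have "\<dots> = c * ?E (?u \<mu>) + (1 - c)" by (simp add: int)
  finally have le: "?E (?u \<nu>) \<le> c * ?E (?u \<mu>) + (1 - c)" .
  have "c * ?E (?u \<mu>) \<le> c" using c E[of \<mu>] by (intro mult_left_le) auto
  then have "pgf \<nu> (?E (?u \<nu>)) \<le> pgf \<nu> (c * ?E (?u \<mu>) + (1 - c))"
    using le E[of \<nu>] by (intro pgf_mono) auto
  also have "\<dots> \<le> c * pgf \<mu> (?E (?u \<mu>)) + (1 - c)" by (intro G E)
  finally have "f 0 x * pgf \<nu> (?E (?u \<nu>)) \<le> f 0 x * (c * pgf \<mu> (?E (?u \<mu>)) + (1 - c))"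
    using Suc.prems[of 0 x] by (intro mult_left_mono) auto
  also have "\<dots> \<le> c * (f 0 x * pgf \<mu> (?E (?u \<mu>))) + (1 - c)"
  proof -
    have "(1 - c) * f 0 x \<le> 1 - c" using c Suc.prems[of 0 x] by (intro mult_left_le) auto
    then show ?thesis by (simp add: algebra_simps)
  qed
  finally show ?case by (simp add: generation_step_def)
qed

lemma prob_finite_visits_comparison:
  fixes P :: "'s::countable \<Rightarrow> 's pmf"
  assumes c: "0 < c" "c \<le> 1"
    and G: "\<And>t. t \<in> {0..1} \<Longrightarrow> pgf \<nu> (c * t + (1 - c)) \<le> c * pgf \<mu> t + (1 - c)"
  shows "measure (branching_law P \<nu> x) {B. visits A B \<noteq> \<infinity>}
       \<le> c * measure (branching_law P \<mu> x) {B. visits A B \<noteq> \<infinity>} + (1 - c)"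
proof (rule LIMSEQ_le[OF prob_avoids_tendsto])
  show "(\<lambda>n. c * measure (branching_law P \<mu> x) (avoids A n) + (1 - c))
      \<longlonglongrightarrow> c * measure (branching_law P \<mu> x) {B. visits A B \<noteq> \<infinity>} + (1 - c)"
    by (intro tendsto_intros prob_avoids_tendsto)
  have "measure (branching_law P \<nu> x) (avoids A n)
      \<le> c * measure (branching_law P \<mu> x) (avoids A n) + (1 - c)" for n
  proof (rule LIMSEQ_le[OF path_functional_avoidance_tendsto])
    show "(\<lambda>m. c * path_functional P \<mu> m (avoidance A n) x + (1 - c))
        \<longlonglongrightarrow> c * measure (branching_law P \<mu> x) (avoids A n) + (1 - c)"
      by (intro tendsto_intros path_functional_avoidance_tendsto)
    show "\<exists>N. \<forall>m\<ge>N. path_functional P \<nu> m (avoidance A n) x \<le> c * path_functional P \<mu> m (avoidance A n) x + (1 - c)"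
      by (intro exI allI impI path_functional_comparison[OF c] G avoidance_unit_interval)
  qed
  then show "\<exists>N. \<forall>n\<ge>N. measure (branching_law P \<nu> x) (avoids A n)
      \<le> c * measure (branching_law P \<mu> x) (avoids A n) + (1 - c)" by blast
qed

lemma prob_infinite_visits:
  fixes P :: "'s::countable \<Rightarrow> 's pmf"
  shows "measure (branching_law P \<mu> x) {B. visits A B = \<infinity>}
       = 1 - measure (branching_law P \<mu> x) {B. visits A B \<noteq> \<infinity>}"
    and "{B. visits A B = \<infinity>} \<in> sets (branching_law P \<mu> x)"
proof -
  interpret prob_space "branching_law P \<mu> x" by (rule prob_space_branching_law)
  have "(\<Union>n. avoids A n) = {B. visits A B \<noteq> \<infinity>}"
    unfolding visits_eq_infinity_iff by (auto simp: avoids_def)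
  moreover have "(\<Union>n. avoids A n) \<in> events" by (auto simp: sets_avoids)
  ultimately have *: "{B. visits A B \<noteq> \<infinity>} \<in> events" by simp
  have eq: "{B. visits A B = \<infinity>} = space (branching_law P \<mu> x) - {B. visits A B \<noteq> \<infinity>}"
    by (auto simp: space_branching_law)
  show "{B. visits A B = \<infinity>} \<in> events" unfolding eq by (rule sets.compl_sets[OF *])
  show "prob {B. visits A B = \<infinity>} = 1 - prob {B. visits A B \<noteq> \<infinity>}"
    unfolding eq by (rule prob_compl[OF *])
qed

lemma sets_survives: "{B. survives B} \<in> sets (branching_law P \<mu> x)"
  using measurable_survives[unfolded pred_def] by (simp add: sets_branching_law space_PiM)

text \<open>
  The supremum of the probabilities of finitely many visits satisfies \<open>W \<le> pgf \<mu> W\<close> and \<open>W <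
  1\<close>, while the extinction probability, the limit of the iterates of \<open>pgf \<mu>\<close> from \<open>0\<close>, is a
  fixed point; so \<open>W\<close> is at most the extinction probability. In effect this is a zero-one law
  on survival; it needs only that the bound \<open>d\<close> is uniform in the starting point.
\<close>

lemma infinite_visits_of_uniform_bound:
  fixes P :: "'s::countable \<Rightarrow> 's pmf"
  assumes "supercritical \<mu>" "d < 1"
    and bound: "\<And>x. measure (branching_law P \<mu> x) {B. visits A B \<noteq> \<infinity>} \<le> d"
  shows "measure (branching_law P \<mu> x) {B. survives B}
       \<le> measure (branching_law P \<mu> x) {B. visits A B = \<infinity>}"
proof -
  let ?w = "\<lambda>x. measure (branching_law P \<mu> x) {B. visits A B \<noteq> \<infinity>}"
  let ?w' = "\<lambda>n x. measure (branching_law P \<mu> x) (avoids A n)"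
  have prob: "prob_space (branching_law P \<mu> x)" for x by (rule prob_space_branching_law)
  define W where "W = (SUP x. ?w x)"
  have bdd: "bdd_above (range ?w)" using bound by (auto intro!: bdd_aboveI[where M = d] simp del: infinity_ennreal_def)
  have wW: "?w x \<le> W" for x unfolding W_def by (intro cSUP_upper bdd) simp
  have W: "W \<le> d" unfolding W_def using bound by (intro cSUP_least) auto
  have "?w' (Suc n) x \<le> pgf \<mu> W" for n x
  proof -
    have "?w' n y \<le> W" for y using prob_avoids_le wW by (rule order_trans)
    then have "(\<integral>y. ?w' n y \<partial>measure_pmf (P x)) \<le> W"
      by (intro measure_pmf.integral_le_const measure_pmf.integrable_const_bound[where B = 1])
         (auto simp: prob_space.prob_le_1[OF prob])
    then show ?thesis
      unfolding prob_avoids_Suc generation_step_def using W assms(2)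
      by (intro pgf_mono integral_nonneg) auto
  qed
  then have "?w x \<le> pgf \<mu> W" for x
    by (intro LIMSEQ_le_const2[OF LIMSEQ_Suc[OF prob_avoids_tendsto]]) blast
  then have WG: "W \<le> pgf \<mu> W" unfolding W_def by (intro cSUP_least) auto

  \<comment> \<open>The extinction probability; it is a fixed point of \<open>pgf \<mu>\<close> as the limit of its iterates.\<close>
  define e where "e = 1 - measure (branching_law P \<mu> x) {B. survives B}"
  have q: "(pgf \<mu> ^^ n) 0 \<in> {0..1}" for n
    by (induction n) (use pgf_in_unit_interval in auto)
  have lim: "(\<lambda>n. (pgf \<mu> ^^ n) 0) \<longlonglongrightarrow> e"
    using tendsto_diff[OF tendsto_const[of 1] prob_survives[of \<mu> P x]] by (simp add: e_def)
  have "(\<lambda>n. pgf \<mu> ((pgf \<mu> ^^ n) 0)) \<longlonglongrightarrow> pgf \<mu> e"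
    by (rule pgf_tendsto[OF q lim])
  moreover have "(\<lambda>n. pgf \<mu> ((pgf \<mu> ^^ n) 0)) \<longlonglongrightarrow> e"
    using LIMSEQ_Suc[OF lim] by simp
  ultimately have "pgf \<mu> e = e" by (rule LIMSEQ_unique)
  moreover have "0 \<le> e" using prob_space.prob_le_1[OF prob] by (simp add: e_def)
  moreover have "W < 1" using W assms(2) by simp
  ultimately have "W \<le> e"
    using supersolution_le_fixed_point[OF assms(1), of e W] WG by simp
  with wW[of x] have "?w x \<le> e" by (rule order_trans)
  then show ?thesis unfolding prob_infinite_visits(1) e_def by linarith
qed

text \<open>
  After extinction no more visits occur, so infinitely many visits imply survival almost
  surely. This turns the conditional probability in the definition of recurrence into a ratio
  of unconditional ones.
\<close>

lemma prob_infinite_visits_and_survives: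
  fixes P :: "'s::countable \<Rightarrow> 's pmf"
  shows "measure (branching_law P \<mu> x) {B. visits A B = \<infinity> \<and> survives B}
       = measure (branching_law P \<mu> x) {B. visits A B = \<infinity>}"
proof -
  interpret prob_space "branching_law P \<mu> x" by (rule prob_space_branching_law)
  have "{B. visits A B = \<infinity> \<and> survives B} = {B. visits A B = \<infinity>} \<inter> {B. survives B}" by blast
  then have "{B. visits A B = \<infinity> \<and> survives B} \<in> events"
    by (simp only:) (intro sets.Int prob_infinite_visits sets_survives)
  moreover have "AE B in branching_law P \<mu> x. visits A B = \<infinity> \<longrightarrow> survives B"
    using AE_extinction_absorbing[of P \<mu> x]
  proof eventually_elim
    fix B :: "nat \<Rightarrow> 's multiset"
    assume absorbing: "\<forall>n. B n = {#} \<longrightarrow> (\<forall>k\<ge>n. B k = {#})"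
    show "visits A B = \<infinity> \<longrightarrow> survives B"
    proof
      assume visits: "visits A B = \<infinity>"
      have "B n \<noteq> {#}" for n
      proof -
        obtain k where "k \<ge> n" "set_mset (B k) \<inter> A \<noteq> {}"
          using visits unfolding visits_eq_infinity_iff by blast
        then show ?thesis using absorbing by force
      qed
      then show "survives B" by (simp add: survives_def nonempty_has_size[symmetric])
    qed
  qed
  ultimately show ?thesis
    by (intro finite_measure_eq_AE prob_infinite_visits) (auto elim!: eventually_mono)
qed

theorem theorem1p3:
  fixes P :: "'s::countable \<Rightarrow> 's pmf" and \<mu> \<nu> :: "nat pmf"
  assumes "supercritical \<mu>" and "supercritical \<nu>" and "germ_le \<mu> \<nu>"
  shows "(\<forall>A. transient_set P \<nu> A \<longrightarrow> transient_set P \<mu> A) \<and>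
         (\<forall>A. recurrent_set P \<mu> A \<longrightarrow> recurrent_set P \<nu> A)"
proof -
  let ?w = "\<lambda>\<rho> A x. measure (branching_law P \<rho> x) {B. visits A B \<noteq> \<infinity>}"
  let ?s = "\<lambda>\<rho> x. measure (branching_law P \<rho> x) {B. survives B}"
  obtain c where c: "0 < c" "c \<le> 1"
    and G: "\<And>t. t \<in> {0..1} \<Longrightarrow> pgf \<nu> (c * t + (1 - c)) \<le> c * pgf \<mu> t + (1 - c)"
    using germ_le_imp_pgf_comparison[OF assms(3)] by blast
  have comparison: "?w \<nu> A x \<le> c * ?w \<mu> A x + (1 - c)" for A x
    by (intro prob_finite_visits_comparison c G)
  have le1: "?w \<rho> A x \<le> 1" for \<rho> A x by (rule prob_space.prob_le_1[OF prob_space_branching_law])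
  have transient: "transient_set P \<rho> A \<longleftrightarrow> (\<forall>x. ?w \<rho> A x = 1)" for \<rho> A
    by (auto simp: transient_set_def space_branching_law prob_infinite_visits
        simp del: infinity_ennreal_def)
  have recurrent: "recurrent_set P \<rho> A \<longleftrightarrow> (\<forall>x. ?s \<rho> x > 0 \<and> 1 - ?w \<rho> A x = ?s \<rho> x)" for \<rho> A
  proof -
    have "s > 0 \<and> a / s = 1 \<longleftrightarrow> s > 0 \<and> a = s" for a s :: real by auto
    then show ?thesis
      by (simp only: recurrent_set_def cond_prob_def space_branching_law UNIV_I simp_thms
          prob_infinite_visits_and_survives prob_infinite_visits)
  qed
  have "transient_set P \<mu> A" if "transient_set P \<nu> A" for A
    unfolding transient
  proof
    fix x
    have "1 \<le> c * ?w \<mu> A x + (1 - c)" using comparison[where A = A and x = x] that by (simp add: transient)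
    then have "c * 1 \<le> c * ?w \<mu> A x" by simp
    then have "1 \<le> ?w \<mu> A x" using c(1) by (simp only: mult_le_cancel_left_pos)
    with le1[where \<rho> = \<mu> and A = A and x = x] show "?w \<mu> A x = 1" by simp
  qed
  moreover have "recurrent_set P \<nu> A" if rec: "recurrent_set P \<mu> A" for A
    unfolding recurrent
  proof
    fix x
    have s: "?s \<mu> y = ?s \<mu> x" for y
      by (rule LIMSEQ_unique[OF prob_survives prob_survives])
    \<comment> \<open>Recurrence for \<open>\<mu>\<close> makes the \<open>\<mu>\<close>-probability of infinitely many visits equal to the survival
      probability, the same from every point; the comparison keeps a fraction \<open>c\<close> of it.\<close>
    let ?d = "1 - c * ?s \<mu> x"
    have bound: "?w \<nu> A y \<le> ?d" for y
    proof -
      have "?w \<mu> A y = 1 - ?s \<mu> x" using rec s[of y] unfolding recurrent by (smt (verit))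
      then have "c * ?w \<mu> A y + (1 - c) = ?d" by (simp only: right_diff_distrib)
      with comparison[where A = A and x = y] show ?thesis by (simp only:)
    qed
    have d: "?d < 1" using c(1) rec by (simp add: recurrent)
    have "?s \<nu> x \<le> 1 - ?w \<nu> A x"
      by (rule infinite_visits_of_uniform_bound[OF assms(2) d bound, unfolded prob_infinite_visits(1)])
    moreover have "1 - ?w \<nu> A x \<le> ?s \<nu> x"
    proof -
      interpret prob_space "branching_law P \<nu> x" by (rule prob_space_branching_law)
      have "prob {B. visits A B = \<infinity> \<and> survives B} \<le> prob {B. survives B}"
        by (intro finite_measure_mono sets_survives) auto
      then show ?thesis by (simp only: prob_infinite_visits_and_survives prob_infinite_visits)
    qed
    ultimately show "?s \<nu> x > 0 \<and> 1 - ?w \<nu> A x = ?s \<nu> x"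
      using bound[of x] d by linarith
  qed
  ultimately show ?thesis by blast
qed

end
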